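(* Let $\gamma\in(1,5/3]$, $A\in C^2(\mathbf R_+)$ with $A>0$, and $a=A'/A$. Let $\bar a\in C^1_b(\mathbf R_+)\cap L^1(\mathbf R_+)$ and positive constants $L_1,L_2,U_1,U_2$ satisfy $|a(x)|<l\,\bar a(x)$ for all $x\ge0$ and $$L_1\le U_1,\quad L_2\le U_2,\quad L_2-U_1e^{2\int_0^\infty\bar a(x)dx}>0,\quad \frac{U_2}{L_1}e^{2\int_0^\infty\bar a(x)dx}\le\sigma_2 .$$ If $(z_0(x),w_0(x))\in\Delta_{r,x}$ for every $x\ge0$, $(z_B(t),w_B(t))\in\Delta_{r,0}$ for every $t\ge0$, and (P2) has a smooth solution $(z,w)$ satisfying $\rho\ge0$, then $\Delta_{r,x}$ is an invariant region for (P2): $(z(x,t),w(x,t))\in\Delta_{r,x}$ for every $x\ge0$ and every $t\ge0$ in the time interval of existence of the solution.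
   Context: Notation: $\mathbf R_+=[0,\infty)$; $C^1_b$ denotes $C^1$ functions that are bounded together with their first derivative. $\theta=(\gamma-1)/2$. The problem comes from the isentropic nozzle flow equations $\rho_t+m_x=-a(x)m$, $m_t+(m^2/\rho+p(\rho))_x=-a(x)m^2/\rho$, $p(\rho)=\rho^\gamma/\gamma$, $v=m/\rho$, via the Riemann invariants $w=v+\rho^\theta/\theta$, $z=v-\rho^\theta/\theta$, so that $v=(w+z)/2$ and $\rho=(\theta(w-z)/2)^{1/\theta}$; thus $\rho\ge0$ means $w\ge z$. The characteristic speeds are $\lambda_1=v-\rho^\theta=\frac{\gamma+1}{4}z+\frac{3-\gamma}{4}w$ and $\lambda_2=v+\rho^\theta=\frac{3-\gamma}{4}z+\frac{\gamma+1}{4}w$. Problem (P2): on $x\ge0$, $t\ge0$, $$z_t+\lambda_1z_x=\tfrac{\gamma-1}{8}a(x)(w^2-z^2),\qquad w_t+\lambda_2w_x=-\tfrac{\gamma-1}{8}a(x)(w^2-z^2),$$ with initial data $(z,w)|_{t=0}=(z_0,w_0)$ and boundary condition $(z,w)|_{x=0}=(z_B(t),w_B(t))$. Solutions are considered in the class of bounded $C^1$ functions on $\mathbf R_+\times[0,T]$. Constants $l,\sigma_2$: let $f(r)=\frac{2}{\gamma-1}\,\frac{\gamma+1+(3-\gamma)r}{|r^2-1|}$ (with $f(\pm1)=+\infty$). $l>0$ is the minimum of $f$ on $[-1,1]$; $\sigma_2>1$ is the solution of $f(r)=l$ in $r>1$. Region: $$\Delta_{r,x}=\Big\{(z,w):L_1e^{-\int_0^x\bar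 a(y)dy}\le z\le U_1e^{\int_0^x\bar a(y)dy},\ L_2e^{-\int_0^x\bar a(y)dy}\le w\le U_2e^{\int_0^x\bar a(y)dy},\ w\ge z\Big\}.$$ *)

theory Defs
  imports "HOL-Analysis.Analysis"
begin

(* The derivatives are taken within S, so on closed sets such as [0,\<infinity>) or
   [0,\<infinity>) x [0,T] they are one-sided at the boundary (C1 up to the boundary). *)
definition C1_on :: "'a::real_normed_vector set \<Rightarrow> ('a \<Rightarrow> 'b::real_normed_vector) \<Rightarrow> bool" where
  "C1_on S f \<longleftrightarrow> (\<exists>f' :: 'a \<Rightarrow> 'a \<Rightarrow>\<^sub>L 'b.
     (\<forall>x\<in>S. (f has_derivative blinfun_apply (f' x)) (at x within S)) \<and> continuous_on S f')"

definition deriv_Rp :: "(real \<Rightarrow> real) \<Rightarrow> real \<Rightarrow> real" where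
  "deriv_Rp f x = vector_derivative f (at x within {0..})"

definition C2_Rp :: "(real \<Rightarrow> real) \<Rightarrow> bool" where
  "C2_Rp f \<longleftrightarrow> C1_on {0..} f \<and> C1_on {0..} (deriv_Rp f)"

definition C1b_Rp :: "(real \<Rightarrow> real) \<Rightarrow> bool" where
  "C1b_Rp f \<longleftrightarrow> C1_on {0..} f \<and> bounded (f ` {0..}) \<and> bounded (deriv_Rp f ` {0..})"

definition nozzle_coeff :: "(real \<Rightarrow> real) \<Rightarrow> real \<Rightarrow> real" where
  "nozzle_coeff A x = deriv_Rp A x / A x"

definition lambda1 :: "real \<Rightarrow> real \<Rightarrow> real \<Rightarrow> real" where
  "lambda1 \<gamma> z w = (\<gamma> + 1) / 4 * z + (3 - \<gamma>) / 4 * w"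

definition lambda2 :: "real \<Rightarrow> real \<Rightarrow> real \<Rightarrow> real" where
  "lambda2 \<gamma> z w = (3 - \<gamma>) / 4 * z + (\<gamma> + 1) / 4 * w"

definition partial_x :: "(real \<Rightarrow> real \<Rightarrow> real) \<Rightarrow> real \<Rightarrow> real \<Rightarrow> real" where
  "partial_x u x t = vector_derivative (\<lambda>y. u y t) (at x within {0..})"

definition partial_t :: "real \<Rightarrow> (real \<Rightarrow> real \<Rightarrow> real) \<Rightarrow> real \<Rightarrow> real \<Rightarrow> real" where
  "partial_t T u x t = vector_derivative (\<lambda>s. u x s) (at t within {0..T})"

definition bounded_C1 :: "real \<Rightarrow> (real \<Rightarrow> real \<Rightarrow> real) \<Rightarrow> bool" where
  "bounded_C1 T u \<longleftrightarrow>
     C1_on ({0..} \<times> {0..T}) (\<lambda>(x, t). u x t) \<and> bounded ((\<lambda>(x, t). u x t) ` ({0..} \<times> {0..T}))"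

definition P2_solution ::
  "real \<Rightarrow> (real \<Rightarrow> real) \<Rightarrow> (real \<Rightarrow> real) \<Rightarrow> (real \<Rightarrow> real) \<Rightarrow> (real \<Rightarrow> real) \<Rightarrow> (real \<Rightarrow> real)
    \<Rightarrow> real \<Rightarrow> (real \<Rightarrow> real \<Rightarrow> real) \<Rightarrow> (real \<Rightarrow> real \<Rightarrow> real) \<Rightarrow> bool" where
  "P2_solution \<gamma> a z0 w0 zB wB T z w \<longleftrightarrow>
     bounded_C1 T z \<and> bounded_C1 T w \<and>
     (\<forall>x\<ge>0. \<forall>t\<in>{0..T}.
        partial_t T z x t + lambda1 \<gamma> (z x t) (w x t) * partial_x z x t
          = (\<gamma> - 1) / 8 * a x * ((w x t)\<^sup>2 - (z x t)\<^sup>2)) \<and>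
     (\<forall>x\<ge>0. \<forall>t\<in>{0..T}.
        partial_t T w x t + lambda2 \<gamma> (z x t) (w x t) * partial_x w x t
          = - ((\<gamma> - 1) / 8 * a x * ((w x t)\<^sup>2 - (z x t)\<^sup>2))) \<and>
     (\<forall>x\<ge>0. z x 0 = z0 x \<and> w x 0 = w0 x) \<and>
     (\<forall>t\<in>{0..T}. z 0 t = zB t \<and> w 0 t = wB t)"

definition f_ratio :: "real \<Rightarrow> real \<Rightarrow> ereal" where
  "f_ratio \<gamma> r = (if \<bar>r\<bar> = 1 then \<infinity>
     else ereal (2 / (\<gamma> - 1) * ((\<gamma> + 1 + (3 - \<gamma>) * r) / \<bar>r\<^sup>2 - 1\<bar>)))"

definition l_const :: "real \<Rightarrow> real" where
  "l_const \<gamma> = real_of_ereal (LEAST y. y \<in> f_ratio \<gamma> ` {-1..1})"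

definition sigma2 :: "real \<Rightarrow> real" where
  "sigma2 \<gamma> = (THE r. 1 < r \<and> f_ratio \<gamma> r = ereal (l_const \<gamma>))"

definition Delta_r ::
  "(real \<Rightarrow> real) \<Rightarrow> real \<Rightarrow> real \<Rightarrow> real \<Rightarrow> real \<Rightarrow> real \<Rightarrow> (real \<times> real) set" where
  "Delta_r abar L1 L2 U1 U2 x =
     {(z, w). L1 * exp (- integral {0..x} abar) \<le> z \<and> z \<le> U1 * exp (integral {0..x} abar) \<and>
              L2 * exp (- integral {0..x} abar) \<le> w \<and> w \<le> U2 * exp (integral {0..x} abar) \<and>
              z \<le> w}"

lemma f_ratio_attains_min:
  fixes \<gamma> :: real
  assumes "1 < \<gamma>" "\<gamma> \<le> 5/3"
  obtains l r where "l > 0" "\<bar>r\<bar> < 1" "f_ratio \<gamma> r = ereal l"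
    "\<And>s. \<bar>s\<bar> \<le> 1 \<Longrightarrow> ereal l \<le> f_ratio \<gamma> s"
proof -
  let ?g = "\<lambda>r. 2 / (\<gamma> - 1) * ((\<gamma> + 1 + (3 - \<gamma>) * r) / \<bar>r\<^sup>2 - 1\<bar>)"
  let ?K = "{-1..1} \<inter> {r. \<gamma> + 1 + (3 - \<gamma>) * r \<le> (\<gamma> + 1) * (1 - r\<^sup>2)}"
  have "closed {r::real. \<gamma> + 1 + (3 - \<gamma>) * r \<le> (\<gamma> + 1) * (1 - r\<^sup>2)}"
    by (intro closed_Collect_le continuous_intros)
  then have cK: "compact ?K" by (intro compact_Int_closed) auto
  have K1: "\<bar>r\<bar> < 1" if "r \<in> ?K" for r
  proof -
    have "r \<noteq> 1" "r \<noteq> -1" using that assms by auto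
    with that show ?thesis by auto
  qed
  have sq: "r\<^sup>2 < 1" if "\<bar>r\<bar> < 1" for r :: real using that by (simp add: abs_square_less_1)
  have "continuous_on ?K ?g"
    using K1 sq by (intro continuous_intros) force+
  moreover have "0 \<in> ?K" by auto
  ultimately obtain r where r: "r \<in> ?K" and rmin: "\<And>s. s \<in> ?K \<Longrightarrow> ?g r \<le> ?g s"
    using continuous_attains_inf[OF cK] by blast
  have num: "\<gamma> + 1 + (3 - \<gamma>) * s > 0" if "\<bar>s\<bar> \<le> 1" for s
  proof -
    have "(3 - \<gamma>) * s \<ge> (3 - \<gamma>) * (-1)" using that assms by (intro mult_left_mono) auto
    with assms show ?thesis by auto
  qed
  have r1: "\<bar>r\<bar> < 1" using K1 r by blast
  have pos: "?g r > 0" using num[of r] r1 sq[of r] assms by (simp add: zero_less_mult_iff zero_less_divide_iff)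
  have "?g r \<le> ?g s" if "\<bar>s\<bar> < 1" for s
  proof (cases "s \<in> ?K")
    case True then show ?thesis by (rule rmin)
  next
    case False
    then have "(\<gamma> + 1) * (1 - s\<^sup>2) < \<gamma> + 1 + (3 - \<gamma>) * s" using that by auto
    then have "\<gamma> + 1 \<le> (\<gamma> + 1 + (3 - \<gamma>) * s) / \<bar>s\<^sup>2 - 1\<bar>"
      using sq[OF that] by (simp add: pos_le_divide_eq)
    then have "2 / (\<gamma> - 1) * (\<gamma> + 1) \<le> ?g s" using assms by (intro mult_left_mono) auto
    moreover have "?g r \<le> 2 / (\<gamma> - 1) * (\<gamma> + 1)" using rmin[OF \<open>0 \<in> ?K\<close>] by simp
    ultimately show ?thesis by linarith
  qed
  then have "ereal (?g r) \<le> f_ratio \<gamma> s" if "\<bar>s\<bar> \<le> 1" for s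
    using that by (auto simp: f_ratio_def)
  moreover have "f_ratio \<gamma> r = ereal (?g r)" using r1 by (simp add: f_ratio_def)
  ultimately show ?thesis using that pos r1 by blast
qed

lemma l_const:
  fixes \<gamma> :: real
  assumes "1 < \<gamma>" "\<gamma> \<le> 5/3"
  shows "l_const \<gamma> > 0"
    and "\<exists>r\<in>{-1..1}. f_ratio \<gamma> r = ereal (l_const \<gamma>)"
    and "\<And>s. s \<in> {-1..1} \<Longrightarrow> ereal (l_const \<gamma>) \<le> f_ratio \<gamma> s"
proof -
  obtain l r where l: "l > 0" "\<bar>r\<bar> < 1" "f_ratio \<gamma> r = ereal l"
    "\<And>s. \<bar>s\<bar> \<le> 1 \<Longrightarrow> ereal l \<le> f_ratio \<gamma> s"
    using f_ratio_attains_min[OF assms] by blast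
  have r: "r \<in> {-1..1}" using l(2) by auto
  have "(LEAST y. y \<in> f_ratio \<gamma> ` {-1..1}) = ereal l"
  proof (rule Least_equality)
    show "ereal l \<in> f_ratio \<gamma> ` {-1..1}" using l(3) r by (metis image_eqI)
    show "ereal l \<le> y" if "y \<in> f_ratio \<gamma> ` {-1..1}" for y using that l(4) by auto
  qed
  then have eq: "l_const \<gamma> = l" by (simp add: l_const_def)
  show "l_const \<gamma> > 0" using eq l by simp
  show "\<exists>r\<in>{-1..1}. f_ratio \<gamma> r = ereal (l_const \<gamma>)" using eq l r by auto
  show "\<And>s. s \<in> {-1..1} \<Longrightarrow> ereal (l_const \<gamma>) \<le> f_ratio \<gamma> s" using eq l(4) by auto
qed

lemma sigma2_ex1:
  fixes \<gamma> :: real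
  assumes "1 < \<gamma>" "\<gamma> \<le> 5/3"
  shows "\<exists>!r. 1 < r \<and> f_ratio \<gamma> r = ereal (l_const \<gamma>)"
proof -
  define k where "k = l_const \<gamma> * (\<gamma> - 1) / 2"
  have k: "k > 0" using l_const(1)[OF assms] assms by (simp add: k_def)
  have iff: "f_ratio \<gamma> r = ereal (l_const \<gamma>) \<longleftrightarrow> \<gamma> + 1 + (3 - \<gamma>) * r = k * (r\<^sup>2 - 1)"
    if "1 < r" for r
  proof -
    have "r\<^sup>2 - 1 > 0" using that by (simp add: one_less_power)
    then show ?thesis using that assms by (simp add: f_ratio_def k_def divide_simps; argo)
  qed
  define h where "h r = k * (r\<^sup>2 - 1) - (\<gamma> + 1 + (3 - \<gamma>) * r)" for r
  define R where "R = 1 + 4 / k"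
  have "h 1 \<le> 0" by (simp add: h_def)
  moreover have "k * (R\<^sup>2 - 1) = 4 * (R + 1)"
    using k by (simp add: R_def power2_eq_square field_simps)
  then have hR: "h R = (4 - (3 - \<gamma>)) * R + (3 - \<gamma>)" by (simp add: h_def algebra_simps)
  have R1: "R > 1" using k by (simp add: R_def)
  have "0 \<le> h R" unfolding hR using R1 assms by simp
  moreover have "continuous_on {1..R} h" unfolding h_def by (intro continuous_intros)
  ultimately obtain r where r: "1 \<le> r" "r \<le> R" "h r = 0"
    using IVT'[of h 1 0 R] R1 by auto
  have "h 1 \<noteq> 0" by (simp add: h_def)
  with r have r1: "1 < r" by (cases "r = 1") auto
  have uniq: "s = r" if s: "1 < s" "h s = 0" for s
  proof -
    have "(s - r) * (k * (s + r) - (3 - \<gamma>)) = h s - h r"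
      by (simp add: h_def algebra_simps power2_eq_square)
    then have dis: "s = r \<or> k * (s + r) = 3 - \<gamma>" using s r by auto
    have False if e: "k * (s + r) = 3 - \<gamma>"
    proof -
      have "k * (r\<^sup>2 - 1) = \<gamma> + 1 + k * (s + r) * r" using r e by (simp add: h_def)
      then have "\<gamma> + 1 + k + k * (s * r) = 0" by (simp add: algebra_simps power2_eq_square)
      moreover have "k * (s * r) > 0" using k s r1 by simp
      ultimately show False using k assms by linarith
    qed
    with dis show ?thesis by blast
  qed
  show ?thesis
  proof (rule ex1I[of _ r])
    show "1 < r \<and> f_ratio \<gamma> r = ereal (l_const \<gamma>)" using r1 iff[OF r1] r by (simp add: h_def)
    show "s = r" if "1 < s \<and> f_ratio \<gamma> s = ereal (l_const \<gamma>)" for s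
      using that iff[of s] uniq[of s] by (simp add: h_def)
  qed
qed

end

theory Submission
  imports Defs
begin

text \<open>
  Write $E(x) = \int_0^x \bar a$. At the points of the region where $z > 0$ and
  $w \le \sigma_2 z$, the definitions of $l$ and $\sigma_2$ say exactly that along the
  characteristics $z e^{E}$ and $w e^{E}$ strictly increase while $z e^{-E}$ and
  $w e^{-E}$ strictly decrease. Relax the four bounds by $\epsilon$ and take the first time at
  which one of them becomes an equality on a strip $[0,X]$. There both characteristic speeds are
  positive, so the characteristic through the contact point comes from inside the strip at
  earlier times, which contradicts the strict monotonicity.
\<close>

section \<open>Algebraic bounds from \<open>l_const\<close> and \<open>sigma2\<close>\<close>

text \<open>On [0,1) this is the minimality of \<open>l_const\<close> with the denominator of
  \<open>f_ratio\<close> cleared. Beyond 1, the difference of the two sides is a convex quadratic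
  that is negative at 1 and zero at \<open>sigma2 \<gamma>\<close>, hence nonpositive in between.
  The product form also covers r = 1, where the ratio itself is infinite.\<close>

lemma l_const_bound:
  fixes \<gamma> r :: real
  assumes "1 < \<gamma>" "\<gamma> \<le> 5/3" "0 \<le> r" "r \<le> sigma2 \<gamma>"
  shows "l_const \<gamma> * (\<gamma> - 1) / 2 * \<bar>r\<^sup>2 - 1\<bar> \<le> \<gamma> + 1 + (3 - \<gamma>) * r"
proof -
  define k where "k = l_const \<gamma> * (\<gamma> - 1) / 2"
  have k: "k > 0" using l_const(1)[OF assms(1,2)] assms by (simp add: k_def)
  have num: "\<gamma> + 1 + (3 - \<gamma>) * r > 0"
    using assms by (intro add_pos_nonneg) auto
  have cancel: "2 / (\<gamma> - 1) * Q * ((\<gamma> - 1) / 2) = Q" for Q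
    using assms by simp
  consider "r = 1" | "r < 1" | "r > 1" by linarith
  then have "k * \<bar>r\<^sup>2 - 1\<bar> \<le> \<gamma> + 1 + (3 - \<gamma>) * r"
  proof cases
    case 1 then show ?thesis using num by simp
  next
    case 2
    have "r\<^sup>2 < 1" using 2 assms by (simp add: abs_square_less_1)
    then have p: "\<bar>r\<^sup>2 - 1\<bar> > 0" by simp
    have "ereal (l_const \<gamma>) \<le> f_ratio \<gamma> r" using l_const(3)[OF assms(1,2), of r] 2 assms by auto
    then have "l_const \<gamma> \<le> 2 / (\<gamma> - 1) * ((\<gamma> + 1 + (3 - \<gamma>) * r) / \<bar>r\<^sup>2 - 1\<bar>)"
      using 2 assms by (simp add: f_ratio_def)
    then have "l_const \<gamma> * ((\<gamma> - 1) / 2) \<le>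
        2 / (\<gamma> - 1) * ((\<gamma> + 1 + (3 - \<gamma>) * r) / \<bar>r\<^sup>2 - 1\<bar>) * ((\<gamma> - 1) / 2)"
      using assms by (intro mult_right_mono) auto
    also note cancel
    finally have "l_const \<gamma> * ((\<gamma> - 1) / 2) \<le> (\<gamma> + 1 + (3 - \<gamma>) * r) / \<bar>r\<^sup>2 - 1\<bar>" .
    then show ?thesis using p by (simp add: k_def pos_le_divide_eq)
  next
    case 3
    define s where "s = sigma2 \<gamma>"
    have s: "1 < s" "f_ratio \<gamma> s = ereal (l_const \<gamma>)"
      using theI'[OF sigma2_ex1[OF assms(1,2)]] by (auto simp: s_def sigma2_def)
    have s2: "s\<^sup>2 - 1 > 0" using s by (simp add: one_less_power)
    have r2: "r\<^sup>2 - 1 > 0" using 3 by (simp add: one_less_power)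
    define h where "h q = k * (q\<^sup>2 - 1) - (\<gamma> + 1 + (3 - \<gamma>) * q)" for q
    have "l_const \<gamma> = 2 / (\<gamma> - 1) * ((\<gamma> + 1 + (3 - \<gamma>) * s) / (s\<^sup>2 - 1))"
      using s s2 by (simp add: f_ratio_def)
    then have "k = (\<gamma> + 1 + (3 - \<gamma>) * s) / (s\<^sup>2 - 1)"
      unfolding k_def by (metis cancel times_divide_eq_right)
    then have "h s = 0" using s2 by (simp add: h_def)
    \<comment> \<open>Convexity of \<open>h\<close> between 1 and \<open>s\<close> as an exact
      identity: the affine part of \<open>h\<close> cancels, and the quadratic part leaves the
      leading coefficient \<open>k\<close> times the three gaps.\<close>
    have "(r - 1) * h s + (s - r) * h 1 - (s - 1) * h r = k * ((s - 1) * (s - r) * (r - 1))"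
      by (simp add: h_def algebra_simps power2_eq_square)
    moreover have "k * ((s - 1) * (s - r) * (r - 1)) \<ge> 0"
      using k s 3 assms by (auto simp: s_def)
    moreover have "(s - r) * h 1 \<le> 0"
      using assms by (intro mult_nonneg_nonpos) (auto simp: s_def h_def)
    ultimately have "(s - 1) * h r \<le> 0" using \<open>h s = 0\<close> by simp
    then have "h r \<le> 0" using s(1) by (simp add: mult_le_0_iff)
    then show ?thesis using r2 by (simp add: h_def)
  qed
  then show ?thesis by (simp add: k_def)
qed

text \<open>By homogeneity, 4 \<open>lambda1\<close> z is z^2 times the numerator of
  \<open>f_ratio\<close> at w/z, and 4 \<open>lambda2\<close> w is w^2 times that numerator at z/w.
  So \<open>l_const_bound\<close> at these two ratios controls the source term, and the strict
  inequality for \<open>a\<close> makes both bounds strict. They say that the growth or decay of the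
  weight exp(E) along a characteristic outweighs the source.\<close>

lemma source_bound:
  fixes \<gamma> a b z w :: real
  assumes g: "1 < \<gamma>" "\<gamma> \<le> 5/3" and a: "\<bar>a\<bar> < l_const \<gamma> * b"
    and z: "0 < z" "z \<le> w" "w \<le> sigma2 \<gamma> * z"
  shows "\<bar>(\<gamma> - 1) / 8 * a * (w\<^sup>2 - z\<^sup>2)\<bar> < lambda1 \<gamma> z w * b * z"
    and "\<bar>(\<gamma> - 1) / 8 * a * (w\<^sup>2 - z\<^sup>2)\<bar> < lambda2 \<gamma> z w * b * w"
proof -
  have w: "w > 0" using z by simp
  have l: "l_const \<gamma> > 0" using l_const(1)[OF g] .
  have b: "b > 0" using a l by (smt (verit) zero_less_mult_pos)
  define q where "q = (\<gamma> - 1) / 8 * (w\<^sup>2 - z\<^sup>2)"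
  have q: "q \<ge> 0" using g z by (auto simp: q_def intro!: mult_nonneg_nonneg power_mono)
  have L: "lambda1 \<gamma> z w > 0" "lambda2 \<gamma> z w > 0"
    using g z w by (auto simp: lambda1_def lambda2_def intro!: add_pos_pos mult_pos_pos)
  have s: "sigma2 \<gamma> > 1"
    using theI'[OF sigma2_ex1[OF g]] by (auto simp: sigma2_def)
  have *: "\<bar>(\<gamma> - 1) / 8 * a * (w\<^sup>2 - z\<^sup>2)\<bar> < X * b" if "l_const \<gamma> * q \<le> X" "X > 0" for X
  proof -
    have "(\<gamma> - 1) / 8 * a * (w\<^sup>2 - z\<^sup>2) = a * q" by (simp add: q_def)
    then have e: "\<bar>(\<gamma> - 1) / 8 * a * (w\<^sup>2 - z\<^sup>2)\<bar> = \<bar>a\<bar> * q"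
      using q by (simp only: abs_mult abs_of_nonneg)
    show ?thesis
    \<comment> \<open>Multiplying the strict bound on \<open>a\<close> by \<open>q\<close> keeps it
      strict only for nonzero \<open>q\<close>. When z = w the source vanishes, and positivity of
      \<open>X\<close> and \<open>b\<close> gives strictness instead.\<close>
    proof (cases "q = 0")
      case True then show ?thesis unfolding e using that b by simp
    next
      case False
      then have "\<bar>a\<bar> * q < l_const \<gamma> * b * q" using a q by (intro mult_strict_right_mono) auto
      also have "\<dots> = l_const \<gamma> * q * b" by simp
      also have "\<dots> \<le> X * b" using that b by (intro mult_right_mono) auto
      finally show ?thesis unfolding e .
    qed
  qed
  have "l_const \<gamma> * (\<gamma> - 1) / 2 * \<bar>(w/z)\<^sup>2 - 1\<bar> \<le> \<gamma> + 1 + (3 - \<gamma>) * (w/z)"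
    using z w by (intro l_const_bound g) (auto simp: field_simps)
  moreover have "\<bar>(w/z)\<^sup>2 - 1\<bar> = (w\<^sup>2 - z\<^sup>2) / z\<^sup>2"
    using z by (simp add: field_simps abs_of_nonneg power_mono)
  ultimately have "l_const \<gamma> * (\<gamma> - 1) / 2 * ((w\<^sup>2 - z\<^sup>2) / z\<^sup>2) * z\<^sup>2
      \<le> (\<gamma> + 1 + (3 - \<gamma>) * (w/z)) * z\<^sup>2"
    by (intro mult_right_mono) auto
  also have "\<dots> = 4 * (lambda1 \<gamma> z w * z)"
    using z by (simp add: lambda1_def field_simps power2_eq_square)
  finally have "l_const \<gamma> * q \<le> lambda1 \<gamma> z w * z"
    using z by (simp add: q_def)
  from *[OF this] show "\<bar>(\<gamma> - 1) / 8 * a * (w\<^sup>2 - z\<^sup>2)\<bar> < lambda1 \<gamma> z w * b * z"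
    using L z by (simp add: mult_ac)
  \<comment> \<open>The reciprocal ratio is at most 1, and \<open>sigma2\<close> exceeds 1.\<close>
  have "z / w \<le> sigma2 \<gamma>" using z w s by (smt (verit) divide_le_eq_1)
  then have "l_const \<gamma> * (\<gamma> - 1) / 2 * \<bar>(z/w)\<^sup>2 - 1\<bar> \<le> \<gamma> + 1 + (3 - \<gamma>) * (z/w)"
    using z w by (intro l_const_bound g) auto
  moreover have "\<bar>(z/w)\<^sup>2 - 1\<bar> = (w\<^sup>2 - z\<^sup>2) / w\<^sup>2"
  proof -
    have "(z/w)\<^sup>2 \<le> 1" using z w by (intro power_le_one) auto
    then show ?thesis using w by (simp add: field_simps)
  qed
  ultimately have "l_const \<gamma> * (\<gamma> - 1) / 2 * ((w\<^sup>2 - z\<^sup>2) / w\<^sup>2) * w\<^sup>2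
      \<le> (\<gamma> + 1 + (3 - \<gamma>) * (z/w)) * w\<^sup>2"
    by (intro mult_right_mono) auto
  also have "\<dots> = 4 * (lambda2 \<gamma> z w * w)"
    using w by (simp add: lambda2_def field_simps power2_eq_square)
  finally have "l_const \<gamma> * q \<le> lambda2 \<gamma> z w * w"
    using w by (simp add: q_def)
  from *[OF this] show "\<bar>(\<gamma> - 1) / 8 * a * (w\<^sup>2 - z\<^sup>2)\<bar> < lambda2 \<gamma> z w * b * w"
    using L w by (simp add: mult_ac)
qed

section \<open>Derivatives along the characteristic direction\<close>

lemma C1_on_imp_continuous_on: "C1_on S f \<Longrightarrow> continuous_on S f"
  unfolding C1_on_def by (auto intro: has_derivative_continuous_on)

text \<open>Restricting the total derivative to the two coordinate lines identifies its coefficients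
  with the partials, which at the boundary are one-sided. Positivity of \<open>T\<close> makes the
  time interval nondegenerate, so that the derivative in t is unique.\<close>

lemma C1_on_has_derivative_partials:
  assumes C: "C1_on ({0..} \<times> {0..T}) (\<lambda>(x, t). u x t)"
    and x: "0 \<le> x" and t: "t \<in> {0..T}" and T: "0 < T"
  shows "((\<lambda>(x, t). u x t) has_derivative
           (\<lambda>(h, k). h * partial_x u x t + k * partial_t T u x t)) (at (x, t) within {0..} \<times> {0..T})"
proof -
  let ?S = "{0::real..} \<times> {0..T}"
  obtain f' where f': "((\<lambda>(x, t). u x t) has_derivative blinfun_apply f') (at (x, t) within ?S)"
    using C x t unfolding C1_on_def by (metis (mono_tags, lifting) SigmaI atLeast_iff)
  interpret f': bounded_linear "blinfun_apply f'" by (rule blinfun.bounded_linear_right)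
  have f'1: "blinfun_apply f' \<circ> (\<lambda>h. (h, 0)) = (\<lambda>h. h *\<^sub>R f' (1, 0))"
  proof
    show "(blinfun_apply f' \<circ> (\<lambda>h. (h, 0))) h = h *\<^sub>R f' (1, 0)" for h
      using f'.scaleR[of h "(1, 0)"] by simp
  qed
  have f'2: "blinfun_apply f' \<circ> (\<lambda>h. (0, h)) = (\<lambda>h. h *\<^sub>R f' (0, 1))"
  proof
    show "(blinfun_apply f' \<circ> (\<lambda>h. (0, h))) h = h *\<^sub>R f' (0, 1)" for h
      using f'.scaleR[of h "(0, 1)"] by simp
  qed
  have "((\<lambda>(x, t). u x t) \<circ> (\<lambda>y. (y, t)) has_derivative blinfun_apply f' \<circ> (\<lambda>h. (h, 0))) (at x within {0..})"
  proof (rule diff_chain_within)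
    show "((\<lambda>y. (y, t)) has_derivative (\<lambda>h. (h, 0))) (at x within {0..})"
      by (auto intro!: derivative_eq_intros)
    show "((\<lambda>(x, t). u x t) has_derivative blinfun_apply f') (at (x, t) within (\<lambda>y. (y, t)) ` {0..})"
      using f' by (rule has_derivative_subset) (use t in auto)
  qed
  then have "((\<lambda>y. u y t) has_vector_derivative f' (1, 0)) (at x within {0..})"
    unfolding f'1 by (simp add: has_vector_derivative_def o_def)
  moreover have "at x within {0..} \<noteq> bot"
    using at_le[of "{x<..}" "{0..}" x] x by (auto simp: bot_unique subset_iff)
  ultimately have px: "partial_x u x t = f' (1, 0)"
    unfolding partial_x_def by (intro vector_derivative_within)
  have "((\<lambda>(x, t). u x t) \<circ> (\<lambda>s. (x, s)) has_derivative blinfun_apply f' \<circ> (\<lambda>h. (0, h))) (at t within {0..T})"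
  proof (rule diff_chain_within)
    show "((\<lambda>s. (x, s)) has_derivative (\<lambda>h. (0, h))) (at t within {0..T})"
      by (auto intro!: derivative_eq_intros)
    show "((\<lambda>(x, t). u x t) has_derivative blinfun_apply f') (at (x, t) within (\<lambda>s. (x, s)) ` {0..T})"
      using f' by (rule has_derivative_subset) (use x in auto)
  qed
  then have "((\<lambda>s. u x s) has_vector_derivative f' (0, 1)) (at t within {0..T})"
    unfolding f'2 by (simp add: has_vector_derivative_def o_def)
  then have pt: "partial_t T u x t = f' (0, 1)"
    unfolding partial_t_def using t T by (intro vector_derivative_within_closed_interval) auto
  have "blinfun_apply f' = (\<lambda>(h, k). h * partial_x u x t + k * partial_t T u x t)"
  proof
    fix p :: "real \<times> real"
    obtain h k where p: "p = (h, k)" by (cases p)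
    have "f' p = f' (h, 0) + f' (0, k)" by (simp add: p flip: f'.add)
    then show "f' p = (case p of (h, k) \<Rightarrow> h * partial_x u x t + k * partial_t T u x t)"
      using fun_cong[OF f'1, of h] fun_cong[OF f'2, of k] by (simp add: p px pt)
  qed
  with f' show ?thesis by simp
qed

lemma weighted_derivative_along_characteristic:
  fixes E :: "real \<Rightarrow> real"
  assumes C: "C1_on ({0..} \<times> {0..T}) (\<lambda>(x, t). u x t)"
    and x: "0 < x" and t: "0 < t" "t \<le> T" and c: "0 < c"
    and E: "(E has_real_derivative b) (at x within {0..})"
    and d: "d = min t (x / c)"
  shows "((\<lambda>h. u (x - c * h) (t - h) * exp (s * E (x - c * h))) has_real_derivative
     - (partial_t T u x t + c * partial_x u x t + s * (c * b * u x t)) * exp (s * E x)) (at 0 within {0..d})"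
proof -
  have dx: "c * h \<le> x" if "h \<le> d" for h
  proof -
    have "h \<le> x / c" using that d by simp
    then show ?thesis using c by (simp add: field_simps)
  qed
  have "((\<lambda>(x, t). u x t) \<circ> (\<lambda>h. (x - c * h, t - h)) has_derivative
     (\<lambda>(h, k). h * partial_x u x t + k * partial_t T u x t) \<circ> (\<lambda>h. (- c * h, - h))) (at 0 within {0..d})"
  proof (rule diff_chain_within)
    show "((\<lambda>h. (x - c * h, t - h)) has_derivative (\<lambda>h. (- c * h, - h))) (at 0 within {0..d})"
      by (auto intro!: derivative_eq_intros)
    show "((\<lambda>(x, t). u x t) has_derivative (\<lambda>(h, k). h * partial_x u x t + k * partial_t T u x t))
       (at (x - c * 0, t - 0) within (\<lambda>h. (x - c * h, t - h)) ` {0..d})"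
      using C1_on_has_derivative_partials[OF C, of x t] x t dx d
      by (auto intro: has_derivative_subset)
  qed
  then have U: "((\<lambda>h. u (x - c * h) (t - h)) has_real_derivative
     - (partial_t T u x t + c * partial_x u x t)) (at 0 within {0..d})"
    by (auto simp: has_field_derivative_def o_def algebra_simps elim!: has_derivative_eq_rhs)
  have "(E \<circ> (\<lambda>h. x - c * h) has_real_derivative b * (- c)) (at 0 within {0..d})"
  proof (rule DERIV_image_chain)
    show "(E has_real_derivative b) (at (x - c * 0) within (\<lambda>h. x - c * h) ` {0..d})"
      using E dx by (auto intro: DERIV_subset)
    show "((\<lambda>h. x - c * h) has_real_derivative - c) (at 0 within {0..d})"
      by (auto intro!: derivative_eq_intros)
  qed
  then have "((\<lambda>h. E (x - c * h)) has_real_derivative - (b * c)) (at 0 within {0..d})"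
    by (simp add: o_def)
  then show ?thesis
    by (auto intro!: derivative_eq_intros U simp del: minus_add_distrib) (simp add: algebra_simps)
qed

text \<open>If the sign were violated, a short step back along the line would push the weighted
  quantity strictly beyond its contact value, against \<open>before\<close>. As \<open>c\<close> is
  positive, that step lands in \<open>{0..x}\<close>, to the left of x. The factors \<mu> and
  \<sigma> let one statement serve all four bounds: both are 1 for lower bounds and both are -1 for
  upper bounds.\<close>

lemma contact_derivative_sign:
  fixes E :: "real \<Rightarrow> real"
  assumes C: "C1_on ({0..} \<times> {0..T}) (\<lambda>(x, t). u x t)"
    and x: "0 < x" and t: "0 < t" "t \<le> T" and c: "0 < c"
    and E: "(E has_real_derivative b) (at x within {0..})"
    and before: "\<And>y s. y \<in> {0..x} \<Longrightarrow> s \<in> {0..<t} \<Longrightarrow>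
      \<mu> * (u x t * exp (\<sigma> * E x)) \<le> \<mu> * (u y s * exp (\<sigma> * E y))"
  shows "\<mu> * (partial_t T u x t + c * partial_x u x t + \<sigma> * (c * b * u x t)) \<le> 0"
proof (rule ccontr)
  define D where "D = partial_t T u x t + c * partial_x u x t + \<sigma> * (c * b * u x t)"
  assume "\<not> \<mu> * (partial_t T u x t + c * partial_x u x t + \<sigma> * (c * b * u x t)) \<le> 0"
  then have "\<mu> * D * exp (\<sigma> * E x) > 0" unfolding D_def by (simp add: not_le)
  then have neg: "\<mu> * (- D * exp (\<sigma> * E x)) < 0" by (simp add: mult_ac)
  define d where "d = min t (x / c)"
  have d: "d > 0" using t x c by (simp add: d_def)
  obtain e where e: "e > 0" "\<And>h. 0 < h \<Longrightarrow> h \<in> {0..d} \<Longrightarrow> h < e \<Longrightarrow>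
      \<mu> * (u (x - c * h) (t - h) * exp (\<sigma> * E (x - c * h))) < \<mu> * (u x t * exp (\<sigma> * E x))"
    using has_real_derivative_neg_dec_right[OF DERIV_cmult[OF
        weighted_derivative_along_characteristic[OF C x t c E d_def, of \<sigma>, folded D_def]] neg]
    by auto
  define h where "h = min d (e / 2)"
  have h: "0 < h" "h \<le> d" "h < e" using d e by (auto simp: h_def)
  have "h \<le> x / c" "h \<le> t" using h by (auto simp: d_def)
  then have "c * h \<le> x" using c by (simp add: field_simps)
  then have "\<mu> * (u x t * exp (\<sigma> * E x)) \<le> \<mu> * (u (x - c * h) (t - h) * exp (\<sigma> * E (x - c * h)))"
    using h c \<open>h \<le> t\<close> by (intro before) auto
  with e(2)[of h] h show False by auto
qed

section \<open>First contact with the relaxed bounds\<close>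

text \<open>The points with G at most 0 form a nonempty compact set, on which the time coordinate
  attains its minimum. This time is positive by the initial condition, and continuity from earlier
  times forces G to vanish at the minimizer.\<close>

lemma first_zero_time:
  fixes G :: "real \<times> real \<Rightarrow> real"
  assumes cont: "continuous_on ({0..X} \<times> {0..T}) G"
    and init: "\<And>x. x \<in> {0..X} \<Longrightarrow> G (x, 0) > 0"
    and p: "p \<in> {0..X} \<times> {0..T}" "G p \<le> 0"
  obtains x t where "x \<in> {0..X}" "0 < t" "t \<le> T" "G (x, t) = 0"
    "\<And>y s. y \<in> {0..X} \<Longrightarrow> s \<in> {0..<t} \<Longrightarrow> G (y, s) > 0"
proof -
  let ?K = "{0..X} \<times> {0..T}"
  define B where "B = {q \<in> ?K. G q \<le> 0}"
  have "compact ?K" by (intro compact_Times) auto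
  moreover have "closed B" unfolding B_def
    using continuous_on_closed_Collect_le[OF cont continuous_on_const[of _ 0]]
    by (simp add: closed_Times)
  ultimately have "compact B"
    by (metis (no_types, lifting) B_def compact_Int_closed inf.absorb_iff2 mem_Collect_eq subsetI)
  moreover have "B \<noteq> {}" using p unfolding B_def by blast
  ultimately obtain q where q: "q \<in> B" "\<And>q'. q' \<in> B \<Longrightarrow> snd q \<le> snd q'"
    using continuous_attains_inf[of B snd] continuous_on_snd[OF continuous_on_id] by metis
  obtain x t where xt: "q = (x, t)" by (cases q)
  have x: "x \<in> {0..X}" "0 \<le> t" "t \<le> T" "G (x, t) \<le> 0" using q xt by (auto simp: B_def)
  have t: "0 < t" using init[OF x(1)] x by (cases "t = 0") auto
  have before: "G (y, s) > 0" if "y \<in> {0..X}" "s \<in> {0..<t}" for y s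
    using q(2)[of "(y, s)"] that x xt by (force simp: B_def)
  \<comment> \<open>Membership in \<open>B\<close> gives only G at most 0; the limit from the left
    along fixed x, where G is positive, supplies the reverse inequality.\<close>
  have "continuous_on {0..t} (\<lambda>s. G (x, s))"
    by (rule continuous_on_compose2[OF cont]) (use x in \<open>auto intro!: continuous_intros\<close>)
  then have "((\<lambda>s. G (x, s)) \<longlongrightarrow> G (x, t)) (at_left t)"
    using t by (simp add: continuous_on_def flip: at_within_Icc_at_left)
  moreover have "eventually (\<lambda>s. 0 \<le> G (x, s)) (at_left t)"
    using eventually_at_left_real[OF t] by eventually_elim (use before x in \<open>auto intro: less_imp_le\<close>)
  ultimately have "0 \<le> G (x, t)" by (rule tendsto_lowerbound) simp
  then show ?thesis using that[of x t] x t before by auto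
qed

text \<open>Strict bounds at t = 0 and x = 0 propagate, because at a first contact
  \<open>source_bound\<close> and \<open>contact_derivative_sign\<close> contradict each other.
  Truncating at \<open>X\<close> gives compactness and needs no data at x = \<open>X\<close>: both
  speeds are positive at the contact point, so the backward lines run to the left. The hypothesis
  \<open>ratio\<close> is what confines w/z to the range of \<open>source_bound\<close>.\<close>

lemma relaxed_region_strict:
  fixes \<gamma> L1 L2 U1 U2 T X :: real and E b a :: "real \<Rightarrow> real"
  assumes g: "1 < \<gamma>" "\<gamma> \<le> 5 / 3"
    and a: "\<And>x. 0 \<le> x \<Longrightarrow> \<bar>a x\<bar> < l_const \<gamma> * b x"
    and E: "\<And>x. 0 \<le> x \<Longrightarrow> (E has_real_derivative b x) (at x within {0..})" and E0: "E 0 = 0"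
    and E_le: "\<And>x. x \<in> {0..X} \<Longrightarrow> E x \<le> E X"
    and L1: "0 < L1" and U2: "0 < U2" and ratio: "U2 * exp (2 * E X) \<le> sigma2 \<gamma> * L1"
    and T: "0 < T" and sol: "P2_solution \<gamma> a z0 w0 zB wB T z w"
    and le: "\<And>x t. 0 \<le> x \<Longrightarrow> t \<in> {0..T} \<Longrightarrow> z x t \<le> w x t"
    and init: "\<And>x. x \<in> {0..X} \<Longrightarrow> L1 < z0 x * exp (E x) \<and> z0 x * exp (- E x) < U1 \<and>
      L2 < w0 x * exp (E x) \<and> w0 x * exp (- E x) < U2"
    and bdry: "\<And>t. t \<in> {0..T} \<Longrightarrow> L1 < zB t \<and> zB t < U1 \<and> L2 < wB t \<and> wB t < U2"
    and x: "x \<in> {0..X}" and t: "t \<in> {0..T}"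
  shows "L1 < z x t * exp (E x) \<and> z x t * exp (- E x) < U1 \<and>
      L2 < w x t * exp (E x) \<and> w x t * exp (- E x) < U2"
proof -
  have Cz: "C1_on ({0..} \<times> {0..T}) (\<lambda>(x, t). z x t)" and Cw: "C1_on ({0..} \<times> {0..T}) (\<lambda>(x, t). w x t)"
    and eqz: "\<And>x t. 0 \<le> x \<Longrightarrow> t \<in> {0..T} \<Longrightarrow> partial_t T z x t + lambda1 \<gamma> (z x t) (w x t) * partial_x z x t
          = (\<gamma> - 1) / 8 * a x * ((w x t)\<^sup>2 - (z x t)\<^sup>2)"
    and eqw: "\<And>x t. 0 \<le> x \<Longrightarrow> t \<in> {0..T} \<Longrightarrow> partial_t T w x t + lambda2 \<gamma> (z x t) (w x t) * partial_x w x t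
          = - ((\<gamma> - 1) / 8 * a x * ((w x t)\<^sup>2 - (z x t)\<^sup>2))"
    and ic: "\<And>x. 0 \<le> x \<Longrightarrow> z x 0 = z0 x \<and> w x 0 = w0 x"
    and bc: "\<And>t. t \<in> {0..T} \<Longrightarrow> z 0 t = zB t \<and> w 0 t = wB t"
    using sol by (auto simp: P2_solution_def bounded_C1_def)
  \<comment> \<open>The least of the four slacks: it is positive exactly when all bounds are strict,
    and zero exactly when all hold weakly with at least one equality.\<close>
  define G where "G = (\<lambda>(x, t). min (min (z x t * exp (E x) - L1) (U1 - z x t * exp (- E x)))
      (min (w x t * exp (E x) - L2) (U2 - w x t * exp (- E x))))"
  have C1_cont: "continuous_on ({0..X} \<times> {0..T}) (\<lambda>p. u (fst p) (snd p))"
    if "C1_on ({0..} \<times> {0..T}) (\<lambda>(x, t). u x t)" for u :: "real \<Rightarrow> real \<Rightarrow> real"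
  proof -
    have "continuous_on ({0..} \<times> {0..T}) (\<lambda>(x, t). u x t)"
      using that by (rule C1_on_imp_continuous_on)
    then have "continuous_on ({0..X} \<times> {0..T}) (\<lambda>(x, t). u x t)"
      by (rule continuous_on_subset) auto
    then show ?thesis by (simp add: case_prod_unfold)
  qed
  have "continuous_on {0..} E" using E by (intro DERIV_continuous_on) auto
  then have "continuous_on ({0..X} \<times> {0..T}) (\<lambda>p. E (fst p))"
    by (rule continuous_on_compose2) (auto intro!: continuous_intros)
  then have cont: "continuous_on ({0..X} \<times> {0..T}) G"
    unfolding G_def case_prod_unfold by (intro continuous_intros C1_cont[OF Cz] C1_cont[OF Cw])
  have G_pos: "G (x, t) > 0 \<longleftrightarrow> L1 < z x t * exp (E x) \<and> z x t * exp (- E x) < U1 \<and>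
      L2 < w x t * exp (E x) \<and> w x t * exp (- E x) < U2" for x t
    by (auto simp: G_def)
  have G_init: "G (y, 0) > 0" if "y \<in> {0..X}" for y
    unfolding G_pos using init[OF that] ic[of y] that by simp
  have "G (x, t) > 0"
  proof (rule ccontr)
    assume "\<not> G (x, t) > 0"
    then obtain x t where x: "x \<in> {0..X}" and t: "0 < t" "t \<le> T" and G0: "G (x, t) = 0"
      and "\<And>y s. y \<in> {0..X} \<Longrightarrow> s \<in> {0..<t} \<Longrightarrow> G (y, s) > 0"
      using first_zero_time[OF cont G_init, of "(x, t)"] \<open>x \<in> {0..X}\<close> \<open>t \<in> {0..T}\<close> by auto
    note before = this(5)[unfolded G_pos]
    have t': "t \<in> {0..T}" using t by simp
    have "x \<noteq> 0" using G_pos[of 0 t] bdry[OF t'] bc[OF t'] E0 G0 by auto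
    then have x0: "0 < x" using x by simp
    have zL: "L1 \<le> z x t * exp (E x)" and wU: "w x t * exp (- E x) \<le> U2"
      using G0 by (auto simp: G_def min_def split: if_splits)
    have z: "z x t > 0" using zL L1 by (smt (verit) exp_gt_zero zero_less_mult_pos2)
    have zw: "z x t \<le> w x t" using le x t' by simp
    have l: "lambda1 \<gamma> (z x t) (w x t) > 0" "lambda2 \<gamma> (z x t) (w x t) > 0"
      using z zw g by (auto simp: lambda1_def lambda2_def intro!: add_pos_pos mult_pos_pos)
    have s: "sigma2 \<gamma> > 0"
      using theI'[OF sigma2_ex1[OF g]] by (auto simp: sigma2_def)
    \<comment> \<open>The upper bound on w carries exp(-E) and the lower bound on z carries exp(E),
      so comparing them costs a factor exp(2E), which \<open>ratio\<close> absorbs. Cancelling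
      exp(E) leaves the bound on w/z.\<close>
    have "w x t * exp (- E x) * exp (2 * E x) \<le> U2 * exp (2 * E X)"
      using wU U2 E_le[OF x] by (intro mult_mono) auto
    also have "\<dots> \<le> sigma2 \<gamma> * (z x t * exp (E x))"
      using s by (intro order_trans[OF ratio] mult_left_mono zL) simp
    also have "w x t * exp (- E x) * exp (2 * E x) = w x t * exp (E x)"
      by (simp add: mult.assoc flip: exp_add)
    finally have "w x t \<le> sigma2 \<gamma> * z x t" by simp
    note S = source_bound[OF g a[of x] z zw this]
    note sign = contact_derivative_sign[OF _ x0 t _ E[of x]]
    have "z x t * exp (E x) = L1 \<or> z x t * exp (- E x) = U1 \<or>
      w x t * exp (E x) = L2 \<or> w x t * exp (- E x) = U2"
      using G0 by (auto simp: G_def min_def split: if_splits)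
    then consider "z x t * exp (E x) = L1" | "z x t * exp (- E x) = U1"
      | "w x t * exp (E x) = L2" | "w x t * exp (- E x) = U2" by blast
    then show False
    \<comment> \<open>With u the component in contact and \<lambda> its speed, the equation turns
      the expression in \<open>sign\<close> into \<lambda> b u plus or minus the source, which
      \<open>S\<close> makes strictly positive.\<close>
    proof cases
      case 1
      show False
        using sign[OF Cz l(1), of 1 1] before x 1 S eqz[of x t] t' by (auto simp: less_imp_le)
    next
      case 2
      show False
        using sign[OF Cz l(1), of "-1" "-1"] before x 2 S eqz[of x t] t' by (auto simp: less_imp_le)
    next
      case 3
      show False
        using sign[OF Cw l(2), of 1 1] before x 3 S eqw[of x t] t' by (auto simp: less_imp_le)
    next
      case 4
      show False
        using sign[OF Cw l(2), of "-1" "-1"] before x 4 S eqw[of x t] t' by (auto simp: less_imp_le)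
    qed
  qed
  then show ?thesis unfolding G_pos .
qed

section \<open>From the relaxed bounds to the closed region\<close>

theorem proposition2p2:
  fixes \<gamma> L1 L2 U1 U2 T :: real
    and A abar z0 w0 zB wB :: "real \<Rightarrow> real"
    and z w :: "real \<Rightarrow> real \<Rightarrow> real"
  assumes "1 < \<gamma>" and "\<gamma> \<le> 5 / 3"
    and "C2_Rp A" and "\<forall>x\<ge>0. A x > 0"
    and "C1b_Rp abar" and "abar absolutely_integrable_on {0..}"
    and "L1 > 0" and "L2 > 0" and "U1 > 0" and "U2 > 0"
    and "\<forall>x\<ge>0. \<bar>nozzle_coeff A x\<bar> < l_const \<gamma> * abar x"
    and "L1 \<le> U1" and "L2 \<le> U2"
    and "L2 - U1 * exp (2 * integral {0..} abar) > 0"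
    and "U2 / L1 * exp (2 * integral {0..} abar) \<le> sigma2 \<gamma>"
    and "\<forall>x\<ge>0. (z0 x, w0 x) \<in> Delta_r abar L1 L2 U1 U2 x"
    and "\<forall>t\<ge>0. (zB t, wB t) \<in> Delta_r abar L1 L2 U1 U2 0"
    and "T > 0"
    and "P2_solution \<gamma> (nozzle_coeff A) z0 w0 zB wB T z w"
    and "\<forall>x\<ge>0. \<forall>t\<in>{0..T}. z x t \<le> w x t"
  shows "\<forall>x\<ge>0. \<forall>t\<in>{0..T}. (z x t, w x t) \<in> Delta_r abar L1 L2 U1 U2 x"
proof -
  define E where "E x = integral {0..x} abar" for x :: real
  have g: "1 < \<gamma>" "\<gamma> \<le> 5/3" by fact+
  have b: "abar x > 0" if "0 \<le> x" for x
    using assms(11) that l_const(1)[OF g] by (smt (verit) zero_less_mult_pos)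
  have cont: "continuous_on {0..} abar"
    using assms(5) by (simp add: C1b_Rp_def C1_on_imp_continuous_on)
  have int: "abar integrable_on {x..y}" if "0 \<le> x" for x y
    by (intro integrable_continuous_real continuous_on_subset[OF cont]) (use that in auto)
  have dE: "(E has_real_derivative abar x) (at x within {0..})" if "0 \<le> x" for x
  proof -
    have "(E has_real_derivative abar x) (at x within {0..x + 1})"
      unfolding E_def
      by (rule integral_has_real_derivative) (use that in \<open>auto intro: continuous_on_subset[OF cont]\<close>)
    moreover have "at x within {0..x + 1} = at x within {0..}"
      by (rule at_within_nhd[of _ "{..<x + 1}"]) (use that in auto)
    ultimately show ?thesis by simp
  qed
  have E_less: "E x < E y" if "0 \<le> x" "x < y" for x y
  proof (rule DERIV_pos_imp_increasing_open[OF that(2)])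
    show "\<exists>D. (E has_real_derivative D) (at u) \<and> 0 < D" if "x < u" "u < y" for u
    proof -
      have "at u within {0..} = at u"
        using that \<open>0 \<le> x\<close> by (intro at_within_interior) (simp add: interior_real_atLeast)
      then show ?thesis using dE[of u] b[of u] that \<open>0 \<le> x\<close> by auto
    qed
    show "continuous_on {x..y} E"
      by (rule continuous_on_subset[OF DERIV_continuous_on[of "{0..}"]]) (use dE that in auto)
  qed
  have E_le: "E y \<le> E x" if "y \<in> {0..x}" for x y
    using E_less[of y x] that by (cases "y = x") auto
  have E_inf: "E x \<le> integral {0..} abar" if "0 \<le> x" for x
    unfolding E_def using that b assms(6) int[of 0 x]
    by (intro integral_subset_le) (auto simp: set_lebesgue_integral_eq_integral less_imp_le)
  \<comment> \<open>Moving the exponentials to the side of the unknowns turns the x-dependent bounds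
    into constant bounds on weighted quantities.\<close>
  have region: "(p, q) \<in> Delta_r abar L1 L2 U1 U2 x \<longleftrightarrow> L1 \<le> p * exp (E x) \<and> p * exp (- E x) \<le> U1 \<and>
      L2 \<le> q * exp (E x) \<and> q * exp (- E x) \<le> U2 \<and> p \<le> q" for p q x
    by (auto simp: Delta_r_def E_def exp_minus field_simps)
  show ?thesis
  proof (intro allI impI ballI)
    fix x t :: real assume x: "0 \<le> x" and t: "t \<in> {0..T}"
    define \<kappa> where "\<kappa> = exp (2 * E x)"
    have \<kappa>: "\<kappa> > 0" by (simp add: \<kappa>_def)
    have s: "sigma2 \<gamma> > 0"
      using theI'[OF sigma2_ex1[OF g]] by (auto simp: sigma2_def)
    \<comment> \<open>\<open>E\<close> still grows after x because \<open>abar\<close> is positive,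
      so the truncated exponential is strictly below the full one. This turns the non-strict
      hypothesis on \<open>sigma2\<close> into the positive room \<open>gap\<close> for the
      relaxation.\<close>
    have "\<kappa> < exp (2 * integral {0..} abar)"
      using E_less[of x "x + 1"] E_inf[of "x + 1"] x by (simp add: \<kappa>_def)
    then have "U2 * \<kappa> < U2 * exp (2 * integral {0..} abar)" using \<open>U2 > 0\<close> by simp
    also have "\<dots> \<le> sigma2 \<gamma> * L1" using assms(15) \<open>L1 > 0\<close> by (simp add: field_simps)
    finally have gap: "sigma2 \<gamma> * L1 - U2 * \<kappa> > 0" by simp
    \<comment> \<open>The first term keeps L1 - e positive; the second is the largest e for which
      the relaxed constants still satisfy (U2 + e) \<kappa> \<le> sigma2 (L1 - e).\<close>
    define e0 where "e0 = min (L1 / 2) ((sigma2 \<gamma> * L1 - U2 * \<kappa>) / (\<kappa> + sigma2 \<gamma>))"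
    have e0: "e0 > 0" using gap \<kappa> s \<open>L1 > 0\<close> by (simp add: e0_def)
    have strict: "L1 - e < z x t * exp (E x) \<and> z x t * exp (- E x) < U1 + e \<and>
      L2 - e < w x t * exp (E x) \<and> w x t * exp (- E x) < U2 + e" if e: "0 < e" "e \<le> e0" for e
    \<comment> \<open>The strip ends at the point under consideration: \<open>X\<close> is x
      itself.\<close>
    proof (rule relaxed_region_strict[where X = x and T = T and z = z and w = w, OF g _ dE _ E_le])
      show "\<bar>nozzle_coeff A x\<bar> < l_const \<gamma> * abar x" if "0 \<le> x" for x using assms(11) that by simp
      show "E 0 = 0" by (simp add: E_def)
      show "0 < L1 - e" "0 < U2 + e" using e assms(7,10) by (auto simp: e0_def)
      have "e \<le> (sigma2 \<gamma> * L1 - U2 * \<kappa>) / (\<kappa> + sigma2 \<gamma>)" using e by (simp add: e0_def)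
      then have "e * (\<kappa> + sigma2 \<gamma>) \<le> sigma2 \<gamma> * L1 - U2 * \<kappa>" using \<kappa> s by (simp add: pos_le_divide_eq)
      then show "(U2 + e) * exp (2 * E x) \<le> sigma2 \<gamma> * (L1 - e)"
        by (simp add: algebra_simps \<kappa>_def)
      show "0 < T" "P2_solution \<gamma> (nozzle_coeff A) z0 w0 zB wB T z w" by fact+
      show "z y s \<le> w y s" if "0 \<le> y" "s \<in> {0..T}" for y s using assms(20) that by simp
      show "L1 - e < z0 y * exp (E y) \<and> z0 y * exp (- E y) < U1 + e \<and>
        L2 - e < w0 y * exp (E y) \<and> w0 y * exp (- E y) < U2 + e" if "y \<in> {0..x}" for y
        using assms(16)[unfolded region, rule_format, of y] that e by auto
      show "L1 - e < zB s \<and> zB s < U1 + e \<and> L2 - e < wB s \<and> wB s < U2 + e" if "s \<in> {0..T}" for s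
        using assms(17)[unfolded region, rule_format, of s] that e by (auto simp: E_def)
      show "x \<in> {0..x}" "t \<in> {0..T}" using x t by auto
    qed
    \<comment> \<open>Letting e tend to 0 recovers the closed bounds, although \<open>strict\<close>
      is available only for e up to \<open>e0\<close>.\<close>
    have lim: "p \<le> q" if "\<And>e. 0 < e \<Longrightarrow> e \<le> e0 \<Longrightarrow> p < q + e" for p q :: real
    proof (rule field_le_epsilon)
      fix e :: real assume "0 < e"
      then show "p \<le> q + e" using that[of "min e e0"] e0 by auto
    qed
    show "(z x t, w x t) \<in> Delta_r abar L1 L2 U1 U2 x"
      unfolding region
    proof (intro conjI)
      show "L1 \<le> z x t * exp (E x)" by (rule lim) (use strict in force)
      show "z x t * exp (- E x) \<le> U1" by (rule lim) (use strict in force)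
      show "L2 \<le> w x t * exp (E x)" by (rule lim) (use strict in force)
      show "w x t * exp (- E x) \<le> U2" by (rule lim) (use strict in force)
      show "z x t \<le> w x t" using assms(20) x t by simp
    qed
  qed
qed

end
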